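(* Let $X,Y$ be compact metric spaces and let $f:X\to X$ and $g:Y\to Y$ be continuous maps. Then the following hold. (a) (Factor relation) If $g$ is a factor of $f$, then $\overline{\mathrm{ac}}(f)\ge\overline{\mathrm{ac}}(g)$ and $\underline{\mathrm{ac}}(f)\ge\underline{\mathrm{ac}}(g)$. In particular, amorphic complexity is an invariant of topological conjugacy. (b) (Power invariance) For all $m\in\mathbb{N}$, $m\geq 1$, we have $\overline{\mathrm{ac}}(f^m)=\overline{\mathrm{ac}}(f)$ and $\underline{\mathrm{ac}}(f^m)=\underline{\mathrm{ac}}(f)$. (c) (Product formula) If upper and lower amorphic complexity coincide for both $f$ and $g$, then the same holds for $f\times g$ and $\mathrm{ac}(f\times g)=\mathrm{ac}(f)+\mathrm{ac}(g)$. Otherwise, $\overline{\mathrm{ac}}(f\times g)\le\overline{\mathrm{ac}}(f)+\overline{\mathrm{ac}}(g)$ and $\underline{\mathrm{ac}}(f\times g)\ge\underline{\mathrm{ac}}(f)+\underline{\mathrm{ac}}(g)$. (d) (Commutation invariance) If $X=Y$ (so that $f$ and $g$ are both continuous self-maps of $X$), then $\overline{\mathrm{ac}}(f\circ g)=\overline{\mathrm{ac}}(g\circ f)$ and $\underline{\mathrm{ac}}(f\circ g)=\underline{\mathrm{ac}}(g\circ f)$.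
   Context: Let $(X,d)$ be a metric space and $f:X\to X$. For $x,y\in X$, $\delta>0$, $n\in\mathbb{N}$ let $S_n(f,\delta,x,y)=\#\{0\le k<n \mid d(f^k(x),f^k(y))\ge\delta\}$. For $\nu\in(0,1]$, points $x,y$ are $(f,\delta,\nu)$-separated if $\limsup_{n\to\infty} S_n(f,\delta,x,y)/n\ge\nu$. A subset $S\subseteq X$ is $(f,\delta,\nu)$-separated if all pairs of distinct points of $S$ are $(f,\delta,\nu)$-separated. $\operatorname{Sep}(f,\delta,\nu)$ is the largest cardinality (possibly $\infty$) of an $(f,\delta,\nu)$-separated subset of $X$. Set $\underline{\mathrm{ac}}(f,\delta)=\liminf_{\nu\to0}\frac{\log\operatorname{Sep}(f,\delta,\nu)}{-\log\nu}$, $\overline{\mathrm{ac}}(f,\delta)=\limsup_{\nu\to0}\frac{\log\operatorname{Sep}(f,\delta,\nu)}{-\log\nu}$. The lower and upper amorphic complexity are $\underline{\mathrm{ac}}(f)=\sup_{\delta>0}\underline{\mathrm{ac}}(f,\delta)$ and $\overline{\mathrm{ac}}(f)=\sup_{\delta>0}\overline{\mathrm{ac}}(f,\delta)$ (values in $[0,\infty]$); if they coincide, the common value is the amorphic complexity $\mathrm{ac}(f)$. $g:Y\to Y$ is a factor of $f:X\to X$ if there is a continuous onto map $h:X\to Y$ with $h\circ f=g\circ h$. The product $X\times Y$ carries the maximum metric, and $(f\times g)(x,y)=(f(x),g(y))$. *)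

theory Defs
  imports "HOL-Analysis.Analysis"
begin

definition sep_count :: "'a metric \<Rightarrow> ('a \<Rightarrow> 'a) \<Rightarrow> real \<Rightarrow> 'a \<Rightarrow> 'a \<Rightarrow> nat \<Rightarrow> nat" where
  "sep_count X f \<delta> x y n = card {k. k < n \<and> mdist X ((f ^^ k) x) ((f ^^ k) y) \<ge> \<delta>}"

definition separated_points :: "'a metric \<Rightarrow> ('a \<Rightarrow> 'a) \<Rightarrow> real \<Rightarrow> real \<Rightarrow> 'a \<Rightarrow> 'a \<Rightarrow> bool" where
  "separated_points X f \<delta> \<nu> x y \<longleftrightarrow>
     limsup (\<lambda>n. ereal (real (sep_count X f \<delta> x y n) / real n)) \<ge> ereal \<nu>"

definition separated_set :: "'a metric \<Rightarrow> ('a \<Rightarrow> 'a) \<Rightarrow> real \<Rightarrow> real \<Rightarrow> 'a set \<Rightarrow> bool" where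
  "separated_set X f \<delta> \<nu> S \<longleftrightarrow>
     S \<subseteq> mspace X \<and> (\<forall>x\<in>S. \<forall>y\<in>S. x \<noteq> y \<longrightarrow> separated_points X f \<delta> \<nu> x y)"

definition sep_number :: "'a metric \<Rightarrow> ('a \<Rightarrow> 'a) \<Rightarrow> real \<Rightarrow> real \<Rightarrow> enat" where
  "sep_number X f \<delta> \<nu> =
     (SUP S\<in>{S. separated_set X f \<delta> \<nu> S}. if finite S then enat (card S) else \<infinity>)"

fun ln_enat :: "enat \<Rightarrow> ereal" where
  "ln_enat (enat n) = (if n = 0 then -\<infinity> else ereal (ln (real n)))"
| "ln_enat \<infinity> = \<infinity>"

definition lower_ac_at :: "'a metric \<Rightarrow> ('a \<Rightarrow> 'a) \<Rightarrow> real \<Rightarrow> ereal" where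
  "lower_ac_at X f \<delta> = Liminf (at_right 0) (\<lambda>\<nu>. ln_enat (sep_number X f \<delta> \<nu>) / ereal (- ln \<nu>))"

definition upper_ac_at :: "'a metric \<Rightarrow> ('a \<Rightarrow> 'a) \<Rightarrow> real \<Rightarrow> ereal" where
  "upper_ac_at X f \<delta> = Limsup (at_right 0) (\<lambda>\<nu>. ln_enat (sep_number X f \<delta> \<nu>) / ereal (- ln \<nu>))"

definition lower_ac :: "'a metric \<Rightarrow> ('a \<Rightarrow> 'a) \<Rightarrow> ereal" where
  "lower_ac X f = (SUP \<delta>\<in>{0<..}. lower_ac_at X f \<delta>)"

definition upper_ac :: "'a metric \<Rightarrow> ('a \<Rightarrow> 'a) \<Rightarrow> ereal" where
  "upper_ac X f = (SUP \<delta>\<in>{0<..}. upper_ac_at X f \<delta>)"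

definition ac_exists :: "'a metric \<Rightarrow> ('a \<Rightarrow> 'a) \<Rightarrow> bool" where
  "ac_exists X f \<longleftrightarrow> lower_ac X f = upper_ac X f"

text \<open>The common value; unspecified when the lower and upper values differ.\<close>
definition ac :: "'a metric \<Rightarrow> ('a \<Rightarrow> 'a) \<Rightarrow> ereal" where
  "ac X f = (THE a. lower_ac X f = a \<and> upper_ac X f = a)"

definition is_factor :: "'a metric \<Rightarrow> ('a \<Rightarrow> 'a) \<Rightarrow> 'b metric \<Rightarrow> ('b \<Rightarrow> 'b) \<Rightarrow> bool" where
  "is_factor X f Y g \<longleftrightarrow>
     (\<exists>h. continuous_map (mtopology_of X) (mtopology_of Y) h \<and> h ` mspace X = mspace Y \<and>
          (\<forall>x\<in>mspace X. h (f x) = g (h x)))"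

definition topologically_conjugate ::
  "'a metric \<Rightarrow> ('a \<Rightarrow> 'a) \<Rightarrow> 'b metric \<Rightarrow> ('b \<Rightarrow> 'b) \<Rightarrow> bool" where
  "topologically_conjugate X f Y g \<longleftrightarrow>
     (\<exists>h. homeomorphic_map (mtopology_of X) (mtopology_of Y) h \<and>
          (\<forall>x\<in>mspace X. h (f x) = g (h x)))"

text \<open>The library's \<^const>\<open>prod_metric\<close> is the Euclidean (square-root) product metric;
  the maximum metric has to be introduced separately.\<close>
definition max_dist :: "('a \<Rightarrow> 'a \<Rightarrow> real) \<Rightarrow> ('b \<Rightarrow> 'b \<Rightarrow> real) \<Rightarrow> 'a \<times> 'b \<Rightarrow> 'a \<times> 'b \<Rightarrow> real" where
  "max_dist d e p q = max (d (fst p) (fst q)) (e (snd p) (snd q))"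

definition max_metric :: "'a metric \<Rightarrow> 'b metric \<Rightarrow> ('a \<times> 'b) metric" where
  "max_metric X Y = metric (mspace X \<times> mspace Y, max_dist (mdist X) (mdist Y))"

lemma Metric_space_max_dist: "Metric_space (mspace X \<times> mspace Y) (max_dist (mdist X) (mdist Y))"
proof
  fix p q
  show "0 \<le> max_dist (mdist X) (mdist Y) p q"
    by (simp add: max_dist_def le_max_iff_disj)
  show "max_dist (mdist X) (mdist Y) p q = max_dist (mdist X) (mdist Y) q p"
    by (simp add: max_dist_def mdist_commute)
next
  fix p q assume "p \<in> mspace X \<times> mspace Y" "q \<in> mspace X \<times> mspace Y"
  moreover have "max a b = 0 \<longleftrightarrow> a = 0 \<and> b = 0" if "a \<ge> 0" "b \<ge> 0" for a b :: real
    using that by linarith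
  ultimately show "max_dist (mdist X) (mdist Y) p q = 0 \<longleftrightarrow> p = q"
    by (auto simp: max_dist_def prod_eq_iff)
next
  fix p q r
  assume "p \<in> mspace X \<times> mspace Y" "q \<in> mspace X \<times> mspace Y" "r \<in> mspace X \<times> mspace Y"
  then have "mdist X (fst p) (fst r) \<le> mdist X (fst p) (fst q) + mdist X (fst q) (fst r)"
    and "mdist Y (snd p) (snd r) \<le> mdist Y (snd p) (snd q) + mdist Y (snd q) (snd r)"
    by (auto intro: mdist_triangle)
  then show "max_dist (mdist X) (mdist Y) p r
      \<le> max_dist (mdist X) (mdist Y) p q + max_dist (mdist X) (mdist Y) q r"
    unfolding max_dist_def by linarith
qed

lemma mspace_max_metric [simp]: "mspace (max_metric X Y) = mspace X \<times> mspace Y"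
  unfolding max_metric_def by (rule Metric_space.mspace_metric[OF Metric_space_max_dist])

lemma mdist_max_metric [simp]: "mdist (max_metric X Y) = max_dist (mdist X) (mdist Y)"
  unfolding max_metric_def by (rule Metric_space.mdist_metric[OF Metric_space_max_dist])

end

theory Submission
  imports Defs
begin

text \<open>
  All parts except the product formula compare the sets of times at which two orbits are
  \<open>\<delta>\<close>-apart. If a map \<open>\<phi>\<close> sends \<open>(f, \<delta>, \<nu>)\<close>-separated pairs to \<open>(g, \<delta>', c * \<nu>)\<close>-separated pairs,
  with \<open>\<delta>'\<close>, \<open>c\<close> and \<open>\<phi>\<close> depending only on \<open>\<delta>\<close>, then \<open>\<phi>\<close> is injective on separated sets, and the
  constant \<open>c\<close> disappears in the exponent. For a factor, \<open>\<phi>\<close> chooses preimages; for powers it is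
  the identity; for \<open>f \<circ> g\<close> and \<open>g \<circ> f\<close> it is \<open>g\<close>, which need not be onto, because
  \<open>(f \<circ> g)^(k+1) = f \<circ> (g \<circ> f)^k \<circ> g\<close>. In each case \<open>\<delta>'\<close> comes from uniform continuity.

  For the product, \<open>Sep(f,\<delta>,\<nu>) Sep(g,\<delta>,\<nu>) \<le> Sep(f\<times>g,\<delta>,\<nu>)
  \<le> Sep(f,\<delta>/2,\<nu>/4) Sep(g,\<delta>/2,\<nu>/4)\<close>: a product of separated sets is separated, and, since maximal
  separated sets span, sending each point to nearby points of maximal separated sets
  in the two factors is injective on a separated set of the product.
\<close>

section \<open>Upper density of sets of times\<close>

definition upper_density :: "nat set \<Rightarrow> ereal" where
  "upper_density A = limsup (\<lambda>n. ereal (real (card {k\<in>A. k < n}) / real n))"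

definition sep_times :: "'a metric \<Rightarrow> ('a \<Rightarrow> 'a) \<Rightarrow> real \<Rightarrow> 'a \<Rightarrow> 'a \<Rightarrow> nat set" where
  "sep_times X f \<delta> x y = {k. \<delta> \<le> mdist X ((f ^^ k) x) ((f ^^ k) y)}"

text \<open>Separation becomes a condition on the density of a set of times, so orbits can be
  compared through inclusions of such sets.\<close>

lemma separated_points_iff:
  "separated_points X f \<delta> \<nu> x y \<longleftrightarrow> ereal \<nu> \<le> upper_density (sep_times X f \<delta> x y)"
  by (simp add: separated_points_def upper_density_def sep_count_def sep_times_def conj_commute)

lemma upper_density_mono:
  assumes "A \<subseteq> B"
  shows "upper_density A \<le> upper_density B"
  unfolding upper_density_def
proof (intro Limsup_mono always_eventually allI)
  fix n
  have "card {k\<in>A. k < n} \<le> card {k\<in>B. k < n}"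
    using assms by (intro card_mono) auto
  then show "ereal (real (card {k\<in>A. k < n}) / real n) \<le> ereal (real (card {k\<in>B. k < n}) / real n)"
    by (simp add: divide_right_mono)
qed

lemma upper_density_empty [simp]: "upper_density {} = 0"
  by (simp add: upper_density_def zero_ereal_def[symmetric] Limsup_const)

lemma upper_density_Un: "upper_density (A \<union> B) \<le> upper_density A + upper_density B"
proof -
  have "upper_density (A \<union> B) \<le> limsup (\<lambda>n. ereal (real (card {k\<in>A. k < n}) / real n) +
      ereal (real (card {k\<in>B. k < n}) / real n))"
    unfolding upper_density_def
  proof (intro Limsup_mono always_eventually allI)
    fix n
    have "{k\<in>A \<union> B. k < n} = {k\<in>A. k < n} \<union> {k\<in>B. k < n}"
      by auto
    then have "card {k\<in>A \<union> B. k < n} \<le> card {k\<in>A. k < n} + card {k\<in>B. k < n}"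
      by (simp add: card_Un_le)
    then have "real (card {k\<in>A \<union> B. k < n}) \<le> real (card {k\<in>A. k < n}) + real (card {k\<in>B. k < n})"
      by linarith
    then show "ereal (real (card {k\<in>A \<union> B. k < n}) / real n)
      \<le> ereal (real (card {k\<in>A. k < n}) / real n) + ereal (real (card {k\<in>B. k < n}) / real n)"
      by (simp add: add_divide_distrib[symmetric] divide_right_mono)
  qed
  also have "\<dots> \<le> upper_density A + upper_density B"
    unfolding upper_density_def by (rule ereal_limsup_add_mono)
  finally show ?thesis .
qed

lemma upper_density_finite:
  assumes "finite A"
  shows "upper_density A = 0"
proof -
  have "(\<lambda>n. real (card {k\<in>A. k < n}) / real n) \<longlonglongrightarrow> 0"
  proof (rule tendsto_sandwich[of "\<lambda>_. 0"])
    show "\<forall>\<^sub>F n in sequentially. real (card {k\<in>A. k < n}) / real n \<le> real (card A) / real n"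
      using assms by (intro always_eventually allI divide_right_mono) (auto intro!: card_mono)
    show "(\<lambda>n. real (card A) / real n) \<longlonglongrightarrow> 0"
      by (rule lim_const_over_n)
  qed auto
  then have "(\<lambda>n. ereal (real (card {k\<in>A. k < n}) / real n)) \<longlonglongrightarrow> ereal 0"
    by simp
  from lim_imp_Limsup[OF _ this] show ?thesis
    by (simp add: upper_density_def zero_ereal_def)
qed

text \<open>Moving every time one step later puts no more elements below any \<open>n\<close>. This
  absorbs the index shift between iterates of \<open>f \<circ> g\<close> and of
  \<open>g \<circ> f\<close>.\<close>

lemma upper_density_Suc_image: "upper_density (Suc ` A) \<le> upper_density A"
  unfolding upper_density_def
proof (intro Limsup_mono always_eventually allI)
  fix n
  have "card {k\<in>Suc ` A. k < n} \<le> card (Suc ` {k\<in>A. k < n})"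
    by (intro card_mono) auto
  also have "\<dots> \<le> card {k\<in>A. k < n}"
    by (intro card_image_le) auto
  finally show "ereal (real (card {k\<in>Suc ` A. k < n}) / real n)
      \<le> ereal (real (card {k\<in>A. k < n}) / real n)"
    by (simp add: divide_right_mono)
qed

text \<open>Along the subsequence \<open>m * n\<close> the counting quotient of the image is at
  least \<open>1 / m\<close> times that of \<open>A\<close> at \<open>n\<close>, and a subsequence
  cannot exceed the full limsup.\<close>

lemma upper_density_times_image:
  assumes "m \<ge> 1"
  shows "ereal (1 / real m) * upper_density A \<le> upper_density ((*) m ` A)"
proof -
  let ?u = "\<lambda>n. ereal (real (card {k\<in>(*) m ` A. k < n}) / real n)"
  have "ereal (1 / real m) * upper_density A
      = limsup (\<lambda>n. ereal (1 / real m) * ereal (real (card {k\<in>A. k < n}) / real n))"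
    unfolding upper_density_def by (rule limsup_ereal_mult_left[symmetric]) simp
  also have "\<dots> \<le> limsup (?u \<circ> (*) m)"
  proof (intro Limsup_mono always_eventually allI)
    fix n
    have "card {k\<in>A. k < n} = card ((*) m ` {k\<in>A. k < n})"
      using assms by (intro card_image[symmetric]) (auto simp: inj_on_def)
    also have "\<dots> \<le> card {k\<in>(*) m ` A. k < m * n}"
      using assms by (intro card_mono) auto
    finally have "real (card {k\<in>A. k < n}) / (real m * real n)
        \<le> real (card {k\<in>(*) m ` A. k < m * n}) / (real m * real n)"
      by (simp add: divide_right_mono)
    then show "ereal (1 / real m) * ereal (real (card {k\<in>A. k < n}) / real n) \<le> (?u \<circ> (*) m) n"
      by simp
  qed
  also have "\<dots> \<le> limsup ?u"
    using assms by (intro limsup_subseq_mono) (auto simp: strict_mono_def)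
  finally show ?thesis
    by (simp add: upper_density_def)
qed

text \<open>The factor \<open>1 / m\<close> is far from optimal, but constant factors do not affect the exponents.\<close>
lemma upper_density_div_vimage:
  assumes "m \<ge> 1"
  shows "ereal (1 / real m) * upper_density {k. k div m \<in> A} \<le> upper_density A"
proof -
  have "ereal (1 / real m) * upper_density {k. k div m \<in> A}
      = limsup (\<lambda>n. ereal (1 / real m) * ereal (real (card {k\<in>{k. k div m \<in> A}. k < n}) / real n))"
    unfolding upper_density_def by (rule limsup_ereal_mult_left[symmetric]) simp
  also have "\<dots> \<le> upper_density A"
    unfolding upper_density_def
  proof (intro Limsup_mono always_eventually allI)
    fix n
    \<comment> \<open>\<open>k\<close> is determined by its remainder, with \<open>m\<close>
      possible values, and its quotient, an element of \<open>A\<close>. The quotient is bounded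
      only by \<open>n\<close>, not by \<open>n / m\<close>; this is where the factor
      \<open>1 / m\<close> is lost.\<close>
    have "{k\<in>{k. k div m \<in> A}. k < n} \<subseteq> (\<lambda>(i, j). m * j + i) ` ({..<m} \<times> {k\<in>A. k < n})"
    proof
      fix k assume k: "k \<in> {k\<in>{k. k div m \<in> A}. k < n}"
      then have "k div m < n"
        by (intro le_less_trans[OF div_le_dividend]) auto
      with k have "(k mod m, k div m) \<in> {..<m} \<times> {k\<in>A. k < n}"
        using assms by auto
      moreover have "k = m * (k div m) + k mod m"
        by simp
      ultimately show "k \<in> (\<lambda>(i, j). m * j + i) ` ({..<m} \<times> {k\<in>A. k < n})"
        by (metis (no_types, lifting) image_eqI old.prod.case)
    qed
    then have "card {k\<in>{k. k div m \<in> A}. k < n} \<le> card ({..<m} \<times> {k\<in>A. k < n})"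
      by (rule surj_card_le[rotated]) auto
    then have "card {k\<in>{k. k div m \<in> A}. k < n} \<le> m * card {k\<in>A. k < n}"
      by (simp add: card_cartesian_product)
    then have "real (card {k\<in>{k. k div m \<in> A}. k < n}) \<le> real m * real (card {k\<in>A. k < n})"
      by (metis of_nat_mono of_nat_mult)
    then have "real (card {k\<in>{k. k div m \<in> A}. k < n}) / real m \<le> real (card {k\<in>A. k < n})"
      using assms by (simp add: divide_le_eq mult.commute)
    from divide_right_mono[OF this, of "real n"]
    show "ereal (1 / real m) * ereal (real (card {k\<in>{k. k div m \<in> A}. k < n}) / real n)
        \<le> ereal (real (card {k\<in>A. k < n}) / real n)"
      by simp
  qed
  finally show ?thesis .
qed

section \<open>Separation times of two orbits\<close>

lemma funpow_mspace:
  assumes "f \<in> mspace X \<rightarrow> mspace X" "x \<in> mspace X"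
  shows "(f ^^ k) x \<in> mspace X"
  using assms by (induction k) auto

lemma sep_times_refl:
  assumes "f \<in> mspace X \<rightarrow> mspace X" "x \<in> mspace X" "\<delta> > 0"
  shows "sep_times X f \<delta> x x = {}"
proof -
  have "mdist X ((f ^^ k) x) ((f ^^ k) x) = 0" for k
    using funpow_mspace[OF assms(1,2)] by simp
  then show ?thesis
    using assms(3) by (simp add: sep_times_def)
qed

lemma sep_times_commute: "sep_times X f \<delta> x y = sep_times X f \<delta> y x"
  by (simp add: sep_times_def mdist_commute)

lemma sep_times_triangle:
  assumes "f \<in> mspace X \<rightarrow> mspace X" "x \<in> mspace X" "y \<in> mspace X" "z \<in> mspace X"
  shows "sep_times X f \<delta> x z \<subseteq> sep_times X f (\<delta> / 2) x y \<union> sep_times X f (\<delta> / 2) y z"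
proof
  fix k assume "k \<in> sep_times X f \<delta> x z"
  moreover have "mdist X ((f ^^ k) x) ((f ^^ k) z)
      \<le> mdist X ((f ^^ k) x) ((f ^^ k) y) + mdist X ((f ^^ k) y) ((f ^^ k) z)"
    using assms by (intro mdist_triangle funpow_mspace)
  ultimately show "k \<in> sep_times X f (\<delta> / 2) x y \<union> sep_times X f (\<delta> / 2) y z"
    unfolding sep_times_def Un_iff mem_Collect_eq by linarith
qed

lemma sep_times_antimono: "\<delta> \<le> \<delta>' \<Longrightarrow> sep_times X f \<delta>' x y \<subseteq> sep_times X f \<delta> x y"
  by (auto simp: sep_times_def)

section \<open>Separated sets and separation numbers\<close>

lemma separated_set_iff:
  "separated_set X f \<delta> \<nu> S \<longleftrightarrow> S \<subseteq> mspace X \<and>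
    (\<forall>x\<in>S. \<forall>y\<in>S. x \<noteq> y \<longrightarrow> ereal \<nu> \<le> upper_density (sep_times X f \<delta> x y))"
  by (simp add: separated_set_def separated_points_iff)

lemma separated_set_subset: "separated_set X f \<delta> \<nu> S \<Longrightarrow> T \<subseteq> S \<Longrightarrow> separated_set X f \<delta> \<nu> T"
  by (auto simp: separated_set_def)

text \<open>Subsets of separated sets are separated, so any witness, even an infinite one, can be
  cut down to exactly \<open>n\<close> points. Only finite sets then have to be counted.\<close>

lemma enat_le_sep_number_iff:
  "enat n \<le> sep_number X f \<delta> \<nu> \<longleftrightarrow> (\<exists>S. separated_set X f \<delta> \<nu> S \<and> finite S \<and> card S = n)"
proof
  assume le: "enat n \<le> sep_number X f \<delta> \<nu>"
  have "\<exists>S. separated_set X f \<delta> \<nu> S \<and> (finite S \<longrightarrow> n \<le> card S)"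
  proof (cases n)
    case 0
    then show ?thesis
      by (auto intro!: exI[of _ "{}"] simp: separated_set_def)
  next
    \<comment> \<open>Attainment of the supremum is not yet known; but it lies strictly above
      \<open>k\<close>, so some member of the family exceeds \<open>k\<close> and hence reaches
      \<open>n\<close>.\<close>
    case (Suc k)
    then have "enat k < sep_number X f \<delta> \<nu>"
      using le by (metis Suc_ile_eq)
    then obtain S where S: "separated_set X f \<delta> \<nu> S" "enat k < (if finite S then enat (card S) else \<infinity>)"
      unfolding sep_number_def less_SUP_iff by blast
    then show ?thesis
      using Suc by (auto split: if_splits)
  qed
  then obtain S where S: "separated_set X f \<delta> \<nu> S" "finite S \<longrightarrow> n \<le> card S"
    by blast
  obtain T where "T \<subseteq> S" "finite T" "card T = n"
    using S(2) by (metis infinite_arbitrarily_large obtain_subset_with_card_n)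
  with S(1) show "\<exists>S. separated_set X f \<delta> \<nu> S \<and> finite S \<and> card S = n"
    using separated_set_subset by blast
next
  assume "\<exists>S. separated_set X f \<delta> \<nu> S \<and> finite S \<and> card S = n"
  then obtain S where "separated_set X f \<delta> \<nu> S" "finite S" "card S = n"
    by blast
  then show "enat n \<le> sep_number X f \<delta> \<nu>"
    unfolding sep_number_def by (intro SUP_upper2[of S]) auto
qed

text \<open>An \<open>enat\<close> is determined by the naturals below it, so infinite separation
  numbers need no separate counting argument.\<close>

lemma enat_leI:
  assumes "\<And>n. enat n \<le> a \<Longrightarrow> enat n \<le> b"
  shows "a \<le> b"
proof (cases a)
  case infinity
  then have "enat (Suc n) \<le> b" for n
    using assms by simp
  then have "b = \<infinity>"
    by (metis enat_ord_simps(1) not_enat_eq not_less_eq_eq order_refl)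
  then show ?thesis
    by simp
qed (use assms in simp)

text \<open>If one factor is infinite and the other at least \<open>1\<close>, testing with
  \<open>n * 1\<close> puts \<open>c\<close> above every natural. A factor \<open>0\<close> is
  treated separately because \<open>0 * \<infinity> = 0\<close>.\<close>

lemma enat_mult_leI:
  assumes "\<And>m n. enat m \<le> a \<Longrightarrow> enat n \<le> b \<Longrightarrow> enat (m * n) \<le> c"
  shows "a * b \<le> c"
proof -
  consider m n where "a = enat m" "b = enat n" | "a = 0 \<or> b = 0"
    | "a = \<infinity>" "enat 1 \<le> b" | "enat 1 \<le> a" "b = \<infinity>"
    by (metis enat_0_iff(1) enat.exhaust enat_ord_simps(1) enat_ord_code(3) less_one not_le one_enat_def)
  then show ?thesis
  proof cases
    case 1
    with assms[of m n] show ?thesis by simp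
  next
    case 2
    then show ?thesis by auto
  next
    case 3
    have "enat n \<le> c" for n
      using assms[of n 1] 3 by simp
    then have "\<infinity> \<le> c"
      by (rule enat_leI)
    then show ?thesis by simp
  next
    case 4
    have "enat n \<le> c" for n
      using assms[of 1 n] 4 by simp
    then have "\<infinity> \<le> c"
      by (rule enat_leI)
    then show ?thesis by simp
  qed
qed

text \<open>A singleton is vacuously separated. Excluding the value \<open>0\<close> keeps the
  logarithms nonnegative, as \<open>ln_enat 0\<close> is \<open>-\<infinity>\<close>.\<close>

lemma sep_number_ge_1:
  assumes "mspace X \<noteq> {}"
  shows "1 \<le> sep_number X f \<delta> \<nu>"
proof -
  obtain x where "x \<in> mspace X"
    using assms by blast
  then have "separated_set X f \<delta> \<nu> {x}"
    by (simp add: separated_set_def)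
  then show ?thesis
    unfolding one_enat_def enat_le_sep_number_iff by (intro exI[of _ "{x}"]) simp
qed

text \<open>Separated points have images with density of separation times at least
  \<open>c * \<nu> > 0\<close>, so \<open>\<phi>\<close> identifies no two of them and the image of
  a separated set has the same cardinality.\<close>

lemma sep_number_le:
  assumes g: "g \<in> mspace Y \<rightarrow> mspace Y" and \<phi>: "\<phi> \<in> mspace X \<rightarrow> mspace Y"
    and pos: "\<delta>' > 0" "c > 0" "\<nu> > 0"
    and le: "\<And>x y. x \<in> mspace X \<Longrightarrow> y \<in> mspace X \<Longrightarrow>
      ereal c * upper_density (sep_times X f \<delta> x y) \<le> upper_density (sep_times Y g \<delta>' (\<phi> x) (\<phi> y))"
  shows "sep_number X f \<delta> \<nu> \<le> sep_number Y g \<delta>' (c * \<nu>)"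
proof (rule enat_leI)
  fix n assume "enat n \<le> sep_number X f \<delta> \<nu>"
  then obtain S where S: "separated_set X f \<delta> \<nu> S" "finite S" "card S = n"
    unfolding enat_le_sep_number_iff by blast
  have sep: "ereal (c * \<nu>) \<le> upper_density (sep_times Y g \<delta>' (\<phi> x) (\<phi> y))"
    if "x \<in> S" "y \<in> S" "x \<noteq> y" for x y
  proof -
    have "ereal \<nu> \<le> upper_density (sep_times X f \<delta> x y)" and "x \<in> mspace X" "y \<in> mspace X"
      using S(1) that unfolding separated_set_iff by auto
    then show ?thesis
      using le[of x y] ereal_mult_left_mono[of "ereal \<nu>" _ "ereal c"] pos(2)
      by (metis ereal_less_eq(5) less_imp_le order_trans times_ereal.simps(1))
  qed
  have sub: "S \<subseteq> mspace X"
    using S(1) by (simp add: separated_set_def)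
  have "inj_on \<phi> S"
  proof (rule inj_onI, rule ccontr)
    fix x y assume xy: "x \<in> S" "y \<in> S" "\<phi> x = \<phi> y" "x \<noteq> y"
    then have "sep_times Y g \<delta>' (\<phi> x) (\<phi> y) = {}"
      using sub \<phi> g pos(1) sep_times_refl[of g Y "\<phi> y" \<delta>'] by auto
    with sep[OF xy(1,2,4)] pos show False
      by (simp add: mult_le_0_iff)
  qed
  then have "card (\<phi> ` S) = n"
    using S(3) by (simp add: card_image)
  moreover have "separated_set Y g \<delta>' (c * \<nu>) (\<phi> ` S)"
    unfolding separated_set_iff using sep sub \<phi> by fastforce
  ultimately show "enat n \<le> sep_number Y g \<delta>' (c * \<nu>)"
    unfolding enat_le_sep_number_iff using S(2) by blast
qed

text \<open>A separated set of maximal cardinality spans.\<close>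
lemma finite_sep_number_spanning:
  assumes f: "f \<in> mspace X \<rightarrow> mspace X" and pos: "\<delta> > 0" "\<nu> > 0"
    and n: "sep_number X f \<delta> \<nu> = enat n"
  obtains S \<pi> where "finite S" "card S = n" "S \<subseteq> mspace X" "\<And>x. x \<in> mspace X \<Longrightarrow> \<pi> x \<in> S"
    "\<And>x. x \<in> mspace X \<Longrightarrow> upper_density (sep_times X f \<delta> x (\<pi> x)) < ereal \<nu>"
proof -
  obtain S where S: "separated_set X f \<delta> \<nu> S" "finite S" "card S = n"
    using n enat_le_sep_number_iff[of n X f \<delta> \<nu>] by auto
  have "\<exists>s\<in>S. upper_density (sep_times X f \<delta> x s) < ereal \<nu>" if x: "x \<in> mspace X" for x
  proof (cases "x \<in> S")
    case True
    then show ?thesis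
      using sep_times_refl[OF f x pos(1)] pos(2) by (intro bexI[of _ x]) auto
  next
    case False
    show ?thesis
    proof (rule ccontr)
      assume "\<not> ?thesis"
      then have "separated_set X f \<delta> \<nu> (insert x S)"
        using S(1) x unfolding separated_set_iff by (auto simp: not_less sep_times_commute)
      then have "enat (Suc n) \<le> sep_number X f \<delta> \<nu>"
        unfolding enat_le_sep_number_iff using S False by (intro exI[of _ "insert x S"]) simp
      with n show False by simp
    qed
  qed
  then have "\<forall>x\<in>mspace X. \<exists>s. s \<in> S \<and> upper_density (sep_times X f \<delta> x s) < ereal \<nu>"
    by blast
  then obtain \<pi> where "\<forall>x\<in>mspace X. \<pi> x \<in> S \<and> upper_density (sep_times X f \<delta> x (\<pi> x)) < ereal \<nu>"
    by (rule bchoice[THEN exE])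
  moreover have "S \<subseteq> mspace X"
    using S(1) by (simp add: separated_set_def)
  ultimately show ?thesis
    using that[of S \<pi>] S(2,3) by simp
qed

text \<open>The triangle inequality through \<open>s\<close> doubles the scale, and the two
  exceptional frequencies add up. Starting from \<open>\<nu> / 4\<close> leaves less than
  \<open>\<nu> / 2\<close> for each of the two coordinates of a product.\<close>

lemma upper_density_sep_times_triangle:
  assumes "f \<in> mspace X \<rightarrow> mspace X" "x \<in> mspace X" "x' \<in> mspace X" "s \<in> mspace X"
    and "upper_density (sep_times X f (\<delta> / 2) x s) < ereal (\<nu> / 4)"
    and "upper_density (sep_times X f (\<delta> / 2) x' s) < ereal (\<nu> / 4)"
  shows "upper_density (sep_times X f \<delta> x x') < ereal (\<nu> / 2)"
proof -
  have "upper_density (sep_times X f \<delta> x x')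
      \<le> upper_density (sep_times X f (\<delta> / 2) x s) + upper_density (sep_times X f (\<delta> / 2) x' s)"
    using order_trans[OF upper_density_mono[OF sep_times_triangle[OF assms(1,2,4,3), of \<delta>]] upper_density_Un]
    by (simp only: sep_times_commute[of X f "\<delta> / 2" s x'])
  also have "\<dots> < ereal (\<nu> / 4) + ereal (\<nu> / 4)"
    using assms(5,6) by (rule ereal_add_strict_mono2)
  finally show ?thesis by simp
qed

section \<open>Separation numbers of products\<close>

lemma map_prod_funpow:
  fixes f :: "'a \<Rightarrow> 'a" and g :: "'b \<Rightarrow> 'b"
  shows "(map_prod f g ^^ k) p = ((f ^^ k) (fst p), (g ^^ k) (snd p))"
  by (induction k) auto

text \<open>A maximum reaches \<open>\<delta>\<close> exactly when one of its two arguments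
  does.\<close>

lemma sep_times_max_metric:
  "sep_times (max_metric X Y) (map_prod f g) \<delta> p q
    = sep_times X f \<delta> (fst p) (fst q) \<union> sep_times Y g \<delta> (snd p) (snd q)"
  by (auto simp: sep_times_def map_prod_funpow max_dist_def le_max_iff_disj)

lemma sep_number_prod_ge:
  "sep_number X f \<delta> \<nu> * sep_number Y g \<delta> \<nu> \<le> sep_number (max_metric X Y) (map_prod f g) \<delta> \<nu>"
proof (rule enat_mult_leI)
  fix m n assume "enat m \<le> sep_number X f \<delta> \<nu>" "enat n \<le> sep_number Y g \<delta> \<nu>"
  then obtain S T where S: "separated_set X f \<delta> \<nu> S" "finite S" "card S = m"
    and T: "separated_set Y g \<delta> \<nu> T" "finite T" "card T = n"
    unfolding enat_le_sep_number_iff by blast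
  have "ereal \<nu> \<le> upper_density (sep_times (max_metric X Y) (map_prod f g) \<delta> p q)"
    if pq: "p \<in> S \<times> T" "q \<in> S \<times> T" "p \<noteq> q" for p q
  proof -
    \<comment> \<open>Distinct pairs differ in some coordinate, and this coordinate alone supplies
      the required density.\<close>
    have "ereal \<nu> \<le> upper_density (sep_times X f \<delta> (fst p) (fst q)) \<or>
      ereal \<nu> \<le> upper_density (sep_times Y g \<delta> (snd p) (snd q))"
      using S(1) T(1) pq unfolding separated_set_iff by (metis mem_Times_iff prod_eq_iff)
    then show ?thesis
      unfolding sep_times_max_metric by (meson Un_upper1 Un_upper2 order_trans upper_density_mono)
  qed
  moreover have "S \<times> T \<subseteq> mspace X \<times> mspace Y"
    using S(1) T(1) by (auto simp: separated_set_def)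
  ultimately have "separated_set (max_metric X Y) (map_prod f g) \<delta> \<nu> (S \<times> T)"
    unfolding separated_set_iff mspace_max_metric by simp
  then show "enat (m * n) \<le> sep_number (max_metric X Y) (map_prod f g) \<delta> \<nu>"
    unfolding enat_le_sep_number_iff using S T
    by (intro exI[of _ "S \<times> T"]) (simp add: card_cartesian_product)
qed

lemma sep_number_prod_le:
  assumes f: "f \<in> mspace X \<rightarrow> mspace X" and g: "g \<in> mspace Y \<rightarrow> mspace Y"
    and ne: "mspace X \<noteq> {}" "mspace Y \<noteq> {}" and pos: "\<delta> > 0" "\<nu> > 0"
  shows "sep_number (max_metric X Y) (map_prod f g) \<delta> \<nu>
    \<le> sep_number X f (\<delta> / 2) (\<nu> / 4) * sep_number Y g (\<delta> / 2) (\<nu> / 4)"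
proof (cases "sep_number X f (\<delta> / 2) (\<nu> / 4) * sep_number Y g (\<delta> / 2) (\<nu> / 4)")
  case infinity
  then show ?thesis by simp
next
  case (enat N)
  let ?A = "sep_number X f (\<delta> / 2) (\<nu> / 4)" and ?B = "sep_number Y g (\<delta> / 2) (\<nu> / 4)"
  \<comment> \<open>Since \<open>0 * \<infinity> = 0\<close>, a finite product forces finite factors
    only when neither vanishes; nonempty carriers ensure that.\<close>
  have "1 \<le> ?A" "1 \<le> ?B"
    using ne by (simp_all only: sep_number_ge_1 not_False_eq_True)
  then have "?A \<noteq> 0" "?B \<noteq> 0"
    by (metis ile0_eq zero_neq_one)+
  moreover have "?A * ?B \<noteq> \<infinity>"
    unfolding enat by simp
  ultimately have "?A \<noteq> \<infinity>" "?B \<noteq> \<infinity>"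
    unfolding imult_is_infinity by simp_all
  then obtain a b where a: "?A = enat a" and b: "?B = enat b"
    unfolding not_infinity_eq by blast
  obtain S \<pi> where S: "finite S" "card S = a" "S \<subseteq> mspace X" "\<And>x. x \<in> mspace X \<Longrightarrow> \<pi> x \<in> S"
    "\<And>x. x \<in> mspace X \<Longrightarrow> upper_density (sep_times X f (\<delta> / 2) x (\<pi> x)) < ereal (\<nu> / 4)"
    by (rule finite_sep_number_spanning[OF f _ _ a]) (use pos in auto)
  obtain T \<rho> where T: "finite T" "card T = b" "T \<subseteq> mspace Y" "\<And>y. y \<in> mspace Y \<Longrightarrow> \<rho> y \<in> T"
    "\<And>y. y \<in> mspace Y \<Longrightarrow> upper_density (sep_times Y g (\<delta> / 2) y (\<rho> y)) < ereal (\<nu> / 4)"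
    by (rule finite_sep_number_spanning[OF g _ _ b]) (use pos in auto)
  show ?thesis
  proof (rule enat_leI)
    fix n assume "enat n \<le> sep_number (max_metric X Y) (map_prod f g) \<delta> \<nu>"
    then obtain R where R: "separated_set (max_metric X Y) (map_prod f g) \<delta> \<nu> R" "finite R" "card R = n"
      unfolding enat_le_sep_number_iff by blast
    have sub: "R \<subseteq> mspace X \<times> mspace Y"
      using R(1) by (simp add: separated_set_def)
    have "inj_on (map_prod \<pi> \<rho>) R"
    proof (rule inj_onI, rule ccontr)
      fix p q assume pq: "p \<in> R" "q \<in> R" "map_prod \<pi> \<rho> p = map_prod \<pi> \<rho> q" "p \<noteq> q"
      then have eq: "\<pi> (fst p) = \<pi> (fst q)" "\<rho> (snd p) = \<rho> (snd q)"
        by (auto simp: prod_eq_iff)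
      have mem: "fst p \<in> mspace X" "fst q \<in> mspace X" "snd p \<in> mspace Y" "snd q \<in> mspace Y"
        using pq(1,2) sub by auto
      \<comment> \<open>With equal nearby points in both coordinates, each coordinate contributes
        density below \<open>\<nu> / 2\<close>, against the density \<open>\<nu>\<close> required by
        separation.\<close>
      have "ereal \<nu> \<le> upper_density (sep_times X f \<delta> (fst p) (fst q) \<union> sep_times Y g \<delta> (snd p) (snd q))"
        using R(1) pq unfolding separated_set_iff sep_times_max_metric by blast
      also have "\<dots> \<le> upper_density (sep_times X f \<delta> (fst p) (fst q))
          + upper_density (sep_times Y g \<delta> (snd p) (snd q))"
        by (rule upper_density_Un)
      also have "\<dots> < ereal (\<nu> / 2) + ereal (\<nu> / 2)"
      proof (rule ereal_add_strict_mono2)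
        show "upper_density (sep_times X f \<delta> (fst p) (fst q)) < ereal (\<nu> / 2)"
          using S(5)[OF mem(1)] S(5)[OF mem(2)] S(3,4) eq(1) mem
          by (intro upper_density_sep_times_triangle[OF f, of _ _ "\<pi> (fst p)"]) auto
        show "upper_density (sep_times Y g \<delta> (snd p) (snd q)) < ereal (\<nu> / 2)"
          using T(5)[OF mem(3)] T(5)[OF mem(4)] T(3,4) eq(2) mem
          by (intro upper_density_sep_times_triangle[OF g, of _ _ "\<rho> (snd p)"]) auto
      qed
      finally show False by simp
    qed
    moreover have "map_prod \<pi> \<rho> ` R \<subseteq> S \<times> T"
      using S(4) T(4) sub by fastforce
    ultimately have "n \<le> card (S \<times> T)"
      using R(3) S(1) T(1) by (metis card_inj_on_le finite_cartesian_product)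
    then show "enat n \<le> sep_number X f (\<delta> / 2) (\<nu> / 4) * sep_number Y g (\<delta> / 2) (\<nu> / 4)"
      using S(2) T(2) by (simp add: a b card_cartesian_product)
  qed
qed

section \<open>Extended logarithms and limits superior of sums\<close>

lemma ln_enat_mono: "a \<le> b \<Longrightarrow> ln_enat a \<le> ln_enat b"
  by (cases a; cases b) auto

lemma ln_enat_nonneg: "1 \<le> a \<Longrightarrow> 0 \<le> ln_enat a"
  by (cases a) (auto simp: one_enat_def)

text \<open>For \<open>a = 0\<close> and \<open>b = \<infinity>\<close> the two sides would be
  \<open>-\<infinity>\<close> and \<open>-\<infinity> + \<infinity> = \<infinity>\<close>; from
  \<open>1\<close> upwards the usual law extends to infinite values.\<close>

lemma ln_enat_mult:
  assumes "1 \<le> a" "1 \<le> b"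
  shows "ln_enat (a * b) = ln_enat a + ln_enat b"
proof -
  have nz: "a \<noteq> 0" "b \<noteq> 0"
    using assms by (metis ile0_eq zero_neq_one)+
  show ?thesis
  proof (cases a)
    case a: (enat m)
    then have m: "m > 0"
      using nz by (simp add: enat_0_iff)
    show ?thesis
    proof (cases b)
      case b: (enat n)
      then have "n > 0"
        using nz by (simp add: enat_0_iff)
      with m a b show ?thesis
        by (simp add: ln_mult)
    next
      case infinity
      with nz show ?thesis
        using a m by (simp add: imult_infinity_right)
    qed
  next
    case infinity
    moreover have "ln_enat b \<noteq> -\<infinity>"
      using ln_enat_nonneg[OF assms(2)] by auto
    ultimately show ?thesis
      using nz by (simp add: imult_infinity)
  qed
qed

text \<open>Nonnegativity keeps both limits above \<open>-\<infinity>\<close>. An infinite limit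
  makes the bound trivial; otherwise both are real, and the slack is split evenly between the
  summands.\<close>

lemma Limsup_add_le:
  fixes u v :: "'a \<Rightarrow> ereal"
  assumes F: "F \<noteq> bot" and nonneg: "\<forall>\<^sub>F x in F. 0 \<le> u x" "\<forall>\<^sub>F x in F. 0 \<le> v x"
  shows "Limsup F (\<lambda>x. u x + v x) \<le> Limsup F u + Limsup F v"
proof -
  have nn: "0 \<le> Limsup F u" "0 \<le> Limsup F v"
    using nonneg by (auto intro: le_Limsup[OF F])
  show ?thesis
  proof (cases "Limsup F u = \<infinity> \<or> Limsup F v = \<infinity>")
    case True
    then show ?thesis by auto
  next
    case False
    then obtain a b where ab: "Limsup F u = ereal a" "Limsup F v = ereal b"
      using nn by (cases "Limsup F u"; cases "Limsup F v") auto
    show ?thesis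
      unfolding Limsup_le_iff
    proof (intro allI impI)
      fix y assume "Limsup F u + Limsup F v < y"
      then obtain r where r: "ereal (a + b) < ereal r" "ereal r < y"
        using ab ereal_dense2 by fastforce
      define e where "e = (r - (a + b)) / 2"
      have e: "e > 0" "(a + e) + (b + e) = r"
        using r(1) by (auto simp: e_def field_simps)
      have "\<forall>\<^sub>F x in F. u x < ereal (a + e)" "\<forall>\<^sub>F x in F. v x < ereal (b + e)"
        using ab e(1) by (auto intro!: Limsup_lessD)
      then show "\<forall>\<^sub>F x in F. u x + v x < y"
      proof eventually_elim
        case (elim x)
        then have "u x + v x < ereal (a + e) + ereal (b + e)"
          by (rule ereal_add_strict_mono2)
        also have "\<dots> = ereal r"
          using e(2) by simp
        finally show ?case
          using r(2) by simp
      qed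
    qed
  qed
qed

section \<open>Logarithmic growth rates and comparison of complexities\<close>

lemma eventually_at_right_0_less_1: "\<forall>\<^sub>F \<nu>::real in at_right 0. 0 < \<nu> \<and> \<nu> < 1"
  by (metis (no_types, lifting) eventually_at_right_field zero_less_one)

lemma log_rate_nonneg:
  fixes F :: "real \<Rightarrow> ereal"
  assumes "\<And>\<nu>. 0 \<le> F \<nu>"
  shows "\<forall>\<^sub>F \<nu> in at_right 0. 0 \<le> F \<nu> / ereal (- ln \<nu>)"
  using eventually_at_right_0_less_1 by eventually_elim (use assms in \<open>simp add: zero_le_divide_ereal\<close>)

text \<open>Since \<open>ln (c * \<nu>) / ln \<nu>\<close> tends to \<open>1\<close>, rescaling the argument does not affect the growth rate.\<close>
lemma log_rate_rescale:
  assumes c: "0 < c" and z: "0 < z" "z < 1" and nonneg: "\<And>\<nu>. 0 \<le> G \<nu>"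
  shows "\<forall>\<^sub>F \<nu> in at_right 0.
    ereal z * (G (c * \<nu>) / ereal (- ln \<nu>)) \<le> G (c * \<nu>) / ereal (- ln (c * \<nu>))"
proof -
  have "filterlim (\<lambda>\<nu>::real. - ln \<nu>) at_top (at_right 0)"
    using ln_at_0 by (simp add: filterlim_uminus_at_top)
  \<comment> \<open>The first bound makes \<open>- ln \<nu>\<close> and
    \<open>- ln (c * \<nu>)\<close> positive. The second is
    \<open>z * (t + \<bar>ln c\<bar>) \<le> t\<close> solved for
    \<open>t = - ln \<nu>\<close>.\<close>
  then have "\<forall>\<^sub>F \<nu>::real in at_right 0. max (\<bar>ln c\<bar> + 1) (\<bar>ln c\<bar> * z / (1 - z)) \<le> - ln \<nu>"
    by (simp only: filterlim_at_top)
  moreover have "\<forall>\<^sub>F \<nu>::real in at_right 0. 0 < \<nu>"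
    by (simp add: eventually_at_right_less)
  ultimately show ?thesis
  proof eventually_elim
    case (elim \<nu>)
    define t where "t = - ln \<nu>"
    define s where "s = - ln (c * \<nu>)"
    have s_eq: "s = t - ln c"
      using c elim(2) by (simp add: s_def t_def ln_mult)
    have t: "t \<ge> \<bar>ln c\<bar> + 1" "t \<ge> \<bar>ln c\<bar> * z / (1 - z)"
      using elim(1) by (auto simp: t_def)
    have pos: "0 < t" "0 < s"
      using t(1) s_eq by auto
    have "\<bar>ln c\<bar> * z \<le> t * (1 - z)"
      using t(2) z by (simp add: divide_le_eq)
    moreover have "z * s \<le> z * t + z * \<bar>ln c\<bar>"
    proof -
      have "z * s \<le> z * (t + \<bar>ln c\<bar>)"
        using z s_eq by (intro mult_left_mono) auto
      then show ?thesis by (simp add: algebra_simps)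
    qed
    ultimately have "z * s \<le> t"
      by (simp add: algebra_simps)
    then have zle: "z / t \<le> 1 / s"
      using pos by (simp add: field_simps)
    have "ereal z * (G (c * \<nu>) / ereal t) = ereal (z / t) * G (c * \<nu>)"
      using pos z by (cases "G (c * \<nu>)") auto
    also have "\<dots> \<le> ereal (1 / s) * G (c * \<nu>)"
      using zle nonneg by (intro ereal_mult_right_mono) auto
    also have "\<dots> = G (c * \<nu>) / ereal s"
      using pos by (cases "G (c * \<nu>)") auto
    finally show ?case
      by (simp only: s_def t_def)
  qed
qed

text \<open>Replacing \<open>\<nu>\<close> by \<open>c * \<nu>\<close> costs at most a factor
  \<open>z < 1\<close> in the rate, with \<open>z\<close> as close to \<open>1\<close> as desired.
  This is how constants in the frequency disappear.\<close>

lemma log_rate_le: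
  fixes F G :: "real \<Rightarrow> ereal"
  assumes c: "0 < c" and nonneg: "\<And>\<nu>. 0 \<le> G \<nu>" and le: "\<And>\<nu>. 0 < \<nu> \<Longrightarrow> F \<nu> \<le> G (c * \<nu>)"
  shows "Limsup (at_right 0) (\<lambda>\<nu>. F \<nu> / ereal (- ln \<nu>)) \<le> Limsup (at_right 0) (\<lambda>\<nu>. G \<nu> / ereal (- ln \<nu>))"
      (is "Limsup _ ?f \<le> Limsup _ ?g")
    and "Liminf (at_right 0) (\<lambda>\<nu>. F \<nu> / ereal (- ln \<nu>)) \<le> Liminf (at_right 0) (\<lambda>\<nu>. G \<nu> / ereal (- ln \<nu>))"
proof -
  have inj: "inj ((*) c)"
    using c by (auto intro: injI)
  \<comment> \<open>Scaling by \<open>c\<close> preserves the filter of right neighbourhoods of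
    \<open>0\<close>, so limits in \<open>c * \<nu>\<close> and in \<open>\<nu>\<close>
    agree.\<close>
  have filt: "filtermap ((*) c) (at_right 0) = at_right (0::real)"
    using filtermap_times_pos_at_right[OF c, of 0] by simp
  note small = eventually_at_right_0_less_1
  have nn: "\<forall>\<^sub>F \<nu> in at_right 0. 0 \<le> ?g \<nu>"
    using nonneg by (rule log_rate_nonneg)
  have le': "\<forall>\<^sub>F \<nu> in at_right 0. ereal z * ?f \<nu> \<le> ?g (c * \<nu>)" if z: "0 < z" "z < 1" for z
    using small log_rate_rescale[of c z G, OF c z nonneg]
  proof eventually_elim
    case (elim \<nu>)
    have "?f \<nu> \<le> G (c * \<nu>) / ereal (- ln \<nu>)"
      using elim le by (intro ereal_divide_right_mono) auto
    then have "ereal z * ?f \<nu> \<le> ereal z * (G (c * \<nu>) / ereal (- ln \<nu>))"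
      using z by (intro ereal_mult_left_mono) auto
    with elim(2) show ?case
      by (rule order_trans[rotated])
  qed
  show "Limsup (at_right 0) ?f \<le> Limsup (at_right 0) ?g"
  \<comment> \<open>It is enough to bound \<open>z\<close> times the left side for all
    \<open>0 < z < 1\<close>, given that the right side is not \<open>-\<infinity>\<close>.\<close>
  proof (rule ereal_le_mult_one_interval)
    have "0 \<le> Limsup (at_right 0) ?g"
      using nn by (intro le_Limsup) auto
    then show "Limsup (at_right 0) ?g \<noteq> -\<infinity>" by auto
    fix z :: ereal assume z: "0 < z" "z < 1"
    then obtain r where r: "z = ereal r" "0 < r" "r < 1"
      by (cases z) auto
    have "z * Limsup (at_right 0) ?f = Limsup (at_right 0) (\<lambda>\<nu>. ereal r * ?f \<nu>)"
      unfolding r(1) using r(2) by (intro Limsup_ereal_mult_left[symmetric]) auto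
    also have "\<dots> \<le> Limsup (at_right 0) (\<lambda>\<nu>. ?g (c * \<nu>))"
      by (rule Limsup_mono[OF le'[OF r(2,3)]])
    also have "\<dots> = Limsup (at_right 0) ?g"
      using Limsup_filtermap_eq[OF inj, of "at_right 0" ?g] unfolding filt by simp
    finally show "z * Limsup (at_right 0) ?f \<le> Limsup (at_right 0) ?g" .
  qed
  show "Liminf (at_right 0) ?f \<le> Liminf (at_right 0) ?g"
  proof (rule ereal_le_mult_one_interval)
    have "0 \<le> Liminf (at_right 0) ?g"
      using nn by (rule Liminf_bounded)
    then show "Liminf (at_right 0) ?g \<noteq> -\<infinity>" by auto
    fix z :: ereal assume z: "0 < z" "z < 1"
    then obtain r where r: "z = ereal r" "0 < r" "r < 1"
      by (cases z) auto
    have "z * Liminf (at_right 0) ?f = Liminf (at_right 0) (\<lambda>\<nu>. ereal r * ?f \<nu>)"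
      unfolding r(1) using r(2) by (intro Liminf_ereal_mult_left[symmetric]) auto
    also have "\<dots> \<le> Liminf (at_right 0) (\<lambda>\<nu>. ?g (c * \<nu>))"
      by (rule Liminf_mono[OF le'[OF r(2,3)]])
    also have "\<dots> = Liminf (at_right 0) ?g"
      using Liminf_filtermap_eq[OF inj, of "at_right 0" ?g] unfolding filt by simp
    finally show "z * Liminf (at_right 0) ?f \<le> Liminf (at_right 0) ?g" .
  qed
qed

text \<open>Common basis for factors, powers, commutation and monotonicity in the scale: each only
  has to supply \<open>\<phi>\<close> and an inequality between densities. One
  \<open>\<delta>'\<close> serves both the upper and the lower rate.\<close>

lemma ac_at_le:
  assumes ne: "mspace Y \<noteq> {}" and g: "g \<in> mspace Y \<rightarrow> mspace Y" and \<phi>: "\<phi> \<in> mspace X \<rightarrow> mspace Y"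
    and pos: "0 < \<delta>'" "0 < c"
    and le: "\<And>x y. x \<in> mspace X \<Longrightarrow> y \<in> mspace X \<Longrightarrow>
      ereal c * upper_density (sep_times X f \<delta> x y) \<le> upper_density (sep_times Y g \<delta>' (\<phi> x) (\<phi> y))"
  shows "upper_ac_at X f \<delta> \<le> upper_ac_at Y g \<delta>'" "lower_ac_at X f \<delta> \<le> lower_ac_at Y g \<delta>'"
proof -
  have nonneg: "0 \<le> ln_enat (sep_number Y g \<delta>' \<nu>)" for \<nu>
    using sep_number_ge_1[OF ne] by (rule ln_enat_nonneg)
  have le_ln: "ln_enat (sep_number X f \<delta> \<nu>) \<le> ln_enat (sep_number Y g \<delta>' (c * \<nu>))" if "0 < \<nu>" for \<nu>
    using sep_number_le[OF g \<phi> pos that le] by (rule ln_enat_mono)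
  show "upper_ac_at X f \<delta> \<le> upper_ac_at Y g \<delta>'" "lower_ac_at X f \<delta> \<le> lower_ac_at Y g \<delta>'"
    unfolding upper_ac_at_def lower_ac_at_def
    using log_rate_le[of c "\<lambda>\<nu>. ln_enat (sep_number Y g \<delta>' \<nu>)" "\<lambda>\<nu>. ln_enat (sep_number X f \<delta> \<nu>)"]
      pos(2) nonneg le_ln by simp_all
qed

lemma ac_le:
  assumes "\<And>\<delta>. 0 < \<delta> \<Longrightarrow>
    \<exists>\<delta>'>0. upper_ac_at X f \<delta> \<le> upper_ac_at Y g \<delta>' \<and> lower_ac_at X f \<delta> \<le> lower_ac_at Y g \<delta>'"
  shows "upper_ac X f \<le> upper_ac Y g" "lower_ac X f \<le> lower_ac Y g"
  unfolding upper_ac_def lower_ac_def using assms by (auto intro!: SUP_mono simp: Bex_def)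

text \<open>Heine-Cantor in contrapositive form, the direction in which separation is pulled back
  from image orbits to the original ones.\<close>

lemma compact_uniformly_continuous:
  assumes "compact_space (mtopology_of X)" "continuous_map (mtopology_of X) (mtopology_of Y) h" "0 < \<delta>"
  obtains \<delta>' where "0 < \<delta>'"
    "\<And>x y. \<lbrakk>x \<in> mspace X; y \<in> mspace X; \<delta> \<le> mdist Y (h x) (h y)\<rbrakk> \<Longrightarrow> \<delta>' \<le> mdist X x y"
proof -
  have "uniformly_continuous_map X Y h"
    using assms(1,2) by (simp add: continuous_imp_uniformly_continuous_map)
  with assms(3) obtain \<delta>' where "0 < \<delta>'"
    "\<forall>x\<in>mspace X. \<forall>y\<in>mspace X. mdist X y x < \<delta>' \<longrightarrow> mdist Y (h y) (h x) < \<delta>"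
    unfolding uniformly_continuous_map_def by blast
  then show ?thesis
    using that by (meson not_le)
qed

section \<open>Factors and topological conjugacy\<close>

lemma factor_ac_le:
  assumes ne: "mspace X \<noteq> {}" and cpt: "compact_space (mtopology_of X)"
    and f: "f \<in> mspace X \<rightarrow> mspace X" and g: "g \<in> mspace Y \<rightarrow> mspace Y" and fact: "is_factor X f Y g"
  shows "upper_ac Y g \<le> upper_ac X f" "lower_ac Y g \<le> lower_ac X f"
proof -
  obtain h where h: "continuous_map (mtopology_of X) (mtopology_of Y) h" "h ` mspace X = mspace Y"
    "\<And>x. x \<in> mspace X \<Longrightarrow> h (f x) = g (h x)"
    using fact unfolding is_factor_def by blast
  have iter: "h ((f ^^ k) x) = (g ^^ k) (h x)" if "x \<in> mspace X" for k x
    using that by (induction k) (simp_all add: h(3) funpow_mspace[OF f])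
  \<comment> \<open>A choice of preimages, not necessarily continuous. Because
    \<open>h (\<phi> y) = y\<close>, the map \<open>h\<close> sends the \<open>f\<close>-orbit of
    \<open>\<phi> y\<close> to the \<open>g\<close>-orbit of \<open>y\<close>.\<close>
  define \<phi> where "\<phi> = inv_into (mspace X) h"
  have \<phi>: "\<phi> y \<in> mspace X" "h (\<phi> y) = y" if "y \<in> mspace Y" for y
    using that h(2) by (auto simp: \<phi>_def inv_into_into f_inv_into_f)
  have "\<exists>\<delta>'>0. upper_ac_at Y g \<delta> \<le> upper_ac_at X f \<delta>'
      \<and> lower_ac_at Y g \<delta> \<le> lower_ac_at X f \<delta>'"
    if "0 < \<delta>" for \<delta>
  proof -
    obtain \<delta>' where \<delta>': "0 < \<delta>'"
      "\<And>x y. \<lbrakk>x \<in> mspace X; y \<in> mspace X; \<delta> \<le> mdist Y (h x) (h y)\<rbrakk> \<Longrightarrow> \<delta>' \<le> mdist X x y"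
      using compact_uniformly_continuous[OF cpt h(1) \<open>0 < \<delta>\<close>] by blast
    have "ereal 1 * upper_density (sep_times Y g \<delta> x y) \<le> upper_density (sep_times X f \<delta>' (\<phi> x) (\<phi> y))"
      if "x \<in> mspace Y" "y \<in> mspace Y" for x y
    proof -
      have "sep_times Y g \<delta> x y \<subseteq> sep_times X f \<delta>' (\<phi> x) (\<phi> y)"
        using that \<phi> by (auto simp: sep_times_def iter intro!: \<delta>'(2) funpow_mspace[OF f])
      then show ?thesis
        using upper_density_mono by simp
    qed
    then show ?thesis
      using ac_at_le[OF ne f _ \<delta>'(1) zero_less_one, of \<phi>] \<phi>(1) \<delta>'(1) by blast
  qed
  from ac_le[OF this] show "upper_ac Y g \<le> upper_ac X f" "lower_ac Y g \<le> lower_ac X f"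
    by simp_all
qed

text \<open>The inverse of a conjugacy intertwines the maps in the opposite order.\<close>

lemma conjugate_imp_factor:
  assumes "topologically_conjugate X f Y g" and f: "f \<in> mspace X \<rightarrow> mspace X"
  shows "is_factor X f Y g" "is_factor Y g X f"
proof -
  obtain h where h: "homeomorphic_map (mtopology_of X) (mtopology_of Y) h"
    "\<And>x. x \<in> mspace X \<Longrightarrow> h (f x) = g (h x)"
    using assms(1) unfolding topologically_conjugate_def by blast
  then obtain k where k: "homeomorphic_maps (mtopology_of X) (mtopology_of Y) h k"
    unfolding homeomorphic_map_maps by blast
  then have cont: "continuous_map (mtopology_of X) (mtopology_of Y) h"
      "continuous_map (mtopology_of Y) (mtopology_of X) k"
    and inv: "\<And>x. x \<in> mspace X \<Longrightarrow> k (h x) = x" "\<And>y. y \<in> mspace Y \<Longrightarrow> h (k y) = y"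
    by (auto simp: homeomorphic_maps_def)
  then have into: "\<And>x. x \<in> mspace X \<Longrightarrow> h x \<in> mspace Y" "\<And>y. y \<in> mspace Y \<Longrightarrow> k y \<in> mspace X"
    by (auto simp: continuous_map_def Pi_iff)
  have "h ` mspace X = mspace Y" "k ` mspace Y = mspace X"
    using into inv by (auto simp: image_iff) metis+
  moreover have "k (g y) = f (k y)" if y: "y \<in> mspace Y" for y
  proof -
    have ky: "k y \<in> mspace X"
      using y by (rule into)
    have "k (g y) = k (h (f (k y)))"
      using h(2)[OF ky] inv(2)[OF y] by simp
    also have "\<dots> = f (k y)"
      using ky f by (intro inv) auto
    finally show ?thesis .
  qed
  ultimately show "is_factor X f Y g" "is_factor Y g X f"
    unfolding is_factor_def using cont h(2) by blast+
qed

section \<open>Powers\<close>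

lemma power_ac_eq:
  assumes ne: "mspace X \<noteq> {}" and cpt: "compact_space (mtopology_of X)"
    and cont: "continuous_map (mtopology_of X) (mtopology_of X) f" and m: "m \<ge> 1"
  shows "upper_ac X (f ^^ m) = upper_ac X f" "lower_ac X (f ^^ m) = lower_ac X f"
proof -
  have f: "f \<in> mspace X \<rightarrow> mspace X"
    using continuous_map_funspace[OF cont] by simp
  have fm: "f ^^ m \<in> mspace X \<rightarrow> mspace X"
    using funpow_mspace[OF f] by auto
  have pow: "((f ^^ m) ^^ k) x = (f ^^ (m * k)) x" for k x
    by (simp add: funpow_mult mult.commute)
  have "\<exists>\<delta>'>0. upper_ac_at X (f ^^ m) \<delta> \<le> upper_ac_at X f \<delta>'
      \<and> lower_ac_at X (f ^^ m) \<delta> \<le> lower_ac_at X f \<delta>'"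
    if "0 < \<delta>" for \<delta>
  proof -
    have "ereal (1 / real m) * upper_density (sep_times X (f ^^ m) \<delta> x y) \<le> upper_density (sep_times X f \<delta> x y)"
      for x y
    proof -
      \<comment> \<open>Time \<open>k\<close> for \<open>f ^^ m\<close> is time \<open>m * k\<close>
        for \<open>f\<close>, so the scale can be kept.\<close>
      have "(*) m ` sep_times X (f ^^ m) \<delta> x y \<subseteq> sep_times X f \<delta> x y"
        by (auto simp: sep_times_def pow)
      then show ?thesis
        using upper_density_times_image[OF m] upper_density_mono by (meson order_trans)
    qed
    then show ?thesis
      using ac_at_le[OF ne f _ that, of "\<lambda>x. x" X "1 / real m"] m that by auto
  qed
  note le = ac_le[OF this]
  have "\<exists>\<delta>'>0. upper_ac_at X f \<delta> \<le> upper_ac_at X (f ^^ m) \<delta>'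
      \<and> lower_ac_at X f \<delta> \<le> lower_ac_at X (f ^^ m) \<delta>'"
    if "0 < \<delta>" for \<delta>
  proof -
    \<comment> \<open>A separation at time \<open>k\<close> occurs \<open>k mod m\<close> steps
      after a multiple of \<open>m\<close>. Uniform continuity of \<open>f ^^ i\<close> traces it
      back \<open>i\<close> steps, at a scale depending on \<open>i\<close>.\<close>
    have "\<exists>e>0. \<forall>x\<in>mspace X. \<forall>y\<in>mspace X. \<delta> \<le> mdist X ((f ^^ i) x) ((f ^^ i) y) \<longrightarrow> e \<le> mdist X x y" for i
    proof -
      have "continuous_map (mtopology_of X) (mtopology_of X) (f ^^ i)"
      proof (induction i)
        case (Suc i)
        then show ?case
          using continuous_map_compose[OF _ cont] by (simp add: o_def)
      qed (simp add: id_def)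
      from compact_uniformly_continuous[OF cpt this \<open>0 < \<delta>\<close>] show ?thesis
        by metis
    qed
    then obtain e where e: "\<And>i. e i > 0"
      "\<And>i x y. \<lbrakk>x \<in> mspace X; y \<in> mspace X; \<delta> \<le> mdist X ((f ^^ i) x) ((f ^^ i) y)\<rbrakk> \<Longrightarrow> e i \<le> mdist X x y"
      by metis
    \<comment> \<open>Only remainders \<open>i < m\<close> occur; the minimum of these finitely many
      scales is positive, and there is at least one because \<open>m \<ge> 1\<close>.\<close>
    define \<delta>' where "\<delta>' = Min (e ` {..<m})"
    have \<delta>': "\<delta>' > 0" "\<And>i. i < m \<Longrightarrow> \<delta>' \<le> e i"
      using e(1) m by (auto simp: \<delta>'_def lessThan_empty_iff)
    have "ereal (1 / real m) * upper_density (sep_times X f \<delta> x y) \<le> upper_density (sep_times X (f ^^ m) \<delta>' x y)"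
      if xy: "x \<in> mspace X" "y \<in> mspace X" for x y
    proof -
      have "sep_times X f \<delta> x y \<subseteq> {k. k div m \<in> sep_times X (f ^^ m) \<delta>' x y}"
      proof
        fix k assume k: "k \<in> sep_times X f \<delta> x y"
        have split: "(f ^^ k) w = (f ^^ (k mod m)) ((f ^^ (m * (k div m))) w)" for w
          using funpow_add[of "k mod m" "m * (k div m)" f] by (simp add: fun_eq_iff)
        have "\<delta>' \<le> e (k mod m)"
          using m by (intro \<delta>') auto
        also have "\<dots> \<le> mdist X ((f ^^ (m * (k div m))) x) ((f ^^ (m * (k div m))) y)"
          using k unfolding sep_times_def mem_Collect_eq split
          by (intro e(2) funpow_mspace[OF f] xy)
        finally show "k \<in> {k. k div m \<in> sep_times X (f ^^ m) \<delta>' x y}"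
          by (simp add: sep_times_def pow)
      qed
      then have "ereal (1 / real m) * upper_density (sep_times X f \<delta> x y)
          \<le> ereal (1 / real m) * upper_density {k. k div m \<in> sep_times X (f ^^ m) \<delta>' x y}"
        by (intro ereal_mult_left_mono upper_density_mono) auto
      then show ?thesis
        using upper_density_div_vimage[OF m] by (rule order_trans)
    qed
    then show ?thesis
      using ac_at_le[OF ne fm _ \<delta>'(1), of "\<lambda>x. x" X "1 / real m"] m \<delta>'(1) by auto
  qed
  note ge = ac_le[OF this]
  show "upper_ac X (f ^^ m) = upper_ac X f" "lower_ac X (f ^^ m) = lower_ac X f"
    using le ge by (auto intro: antisym)
qed

section \<open>Commuted compositions\<close>

lemma comp_ac_le:
  assumes ne: "mspace X \<noteq> {}" and cpt: "compact_space (mtopology_of X)"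
    and contf: "continuous_map (mtopology_of X) (mtopology_of X) f"
    and contg: "continuous_map (mtopology_of X) (mtopology_of X) g"
  shows "upper_ac X (f \<circ> g) \<le> upper_ac X (g \<circ> f)" "lower_ac X (f \<circ> g) \<le> lower_ac X (g \<circ> f)"
proof -
  have f: "f \<in> mspace X \<rightarrow> mspace X" and g: "g \<in> mspace X \<rightarrow> mspace X"
    using continuous_map_funspace[OF contf] continuous_map_funspace[OF contg] by simp_all
  then have gf: "g \<circ> f \<in> mspace X \<rightarrow> mspace X"
    by auto
  \<comment> \<open>The outer \<open>f\<close> will be removed by uniform continuity, leaving a
    separation time of \<open>g x\<close> and \<open>g y\<close> under \<open>g \<circ> f\<close>,
    one step earlier.\<close>
  have iter: "((f \<circ> g) ^^ Suc k) x = f (((g \<circ> f) ^^ k) (g x))" for k x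
    by (induction k) auto
  have "\<exists>\<delta>'>0. upper_ac_at X (f \<circ> g) \<delta> \<le> upper_ac_at X (g \<circ> f) \<delta>'
      \<and> lower_ac_at X (f \<circ> g) \<delta> \<le> lower_ac_at X (g \<circ> f) \<delta>'"
    if "0 < \<delta>" for \<delta>
  proof -
    obtain \<delta>' where \<delta>': "0 < \<delta>'"
      "\<And>x y. \<lbrakk>x \<in> mspace X; y \<in> mspace X; \<delta> \<le> mdist X (f x) (f y)\<rbrakk> \<Longrightarrow> \<delta>' \<le> mdist X x y"
      using compact_uniformly_continuous[OF cpt contf \<open>0 < \<delta>\<close>] by blast
    have "ereal 1 * upper_density (sep_times X (f \<circ> g) \<delta> x y)
        \<le> upper_density (sep_times X (g \<circ> f) \<delta>' (g x) (g y))"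
      if xy: "x \<in> mspace X" "y \<in> mspace X" for x y
    proof -
      let ?B = "sep_times X (g \<circ> f) \<delta>' (g x) (g y)"
      \<comment> \<open>The identity \<open>iter\<close> covers only successor times. Time
        \<open>0\<close> goes into a singleton, which has density \<open>0\<close>.\<close>
      have "sep_times X (f \<circ> g) \<delta> x y \<subseteq> {0} \<union> Suc ` ?B"
      proof
        fix k assume k: "k \<in> sep_times X (f \<circ> g) \<delta> x y"
        show "k \<in> {0} \<union> Suc ` ?B"
        proof (cases k)
          case (Suc j)
          have "\<delta> \<le> mdist X (f (((g \<circ> f) ^^ j) (g x))) (f (((g \<circ> f) ^^ j) (g y)))"
            using k unfolding sep_times_def mem_Collect_eq Suc iter .
          then have "j \<in> ?B"
            unfolding sep_times_def mem_Collect_eq using xy g by (intro \<delta>'(2) funpow_mspace[OF gf]) auto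
          then show ?thesis
            by (simp add: Suc)
        qed simp
      qed
      then have "upper_density (sep_times X (f \<circ> g) \<delta> x y) \<le> upper_density ({0} \<union> Suc ` ?B)"
        by (rule upper_density_mono)
      also have "\<dots> \<le> upper_density {0} + upper_density (Suc ` ?B)"
        by (rule upper_density_Un)
      also have "\<dots> \<le> upper_density ?B"
        by (simp add: upper_density_finite upper_density_Suc_image)
      finally show ?thesis
        by simp
    qed
    then show ?thesis
      using ac_at_le[OF ne gf g \<delta>'(1) zero_less_one] \<delta>'(1) by blast
  qed
  from ac_le[OF this]
  show "upper_ac X (f \<circ> g) \<le> upper_ac X (g \<circ> f)" "lower_ac X (f \<circ> g) \<le> lower_ac X (g \<circ> f)"
    by simp_all
qed

section \<open>Complexity of products\<close>

lemma lower_ac_at_nonneg: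
  assumes "mspace X \<noteq> {}"
  shows "0 \<le> lower_ac_at X f \<delta>"
  unfolding lower_ac_at_def
  by (intro Liminf_bounded log_rate_nonneg ln_enat_nonneg sep_number_ge_1 assms)

lemma lower_ac_le_upper_ac: "lower_ac X f \<le> upper_ac X f"
  unfolding lower_ac_def upper_ac_def lower_ac_at_def upper_ac_at_def
  by (intro SUP_mono bexI) (auto intro: Liminf_le_Limsup)

text \<open>Comparison along the identity with constant \<open>1\<close>: lowering the scale can
  only add separation times.\<close>

lemma lower_ac_at_antimono:
  assumes ne: "mspace X \<noteq> {}" and f: "f \<in> mspace X \<rightarrow> mspace X" and "0 < \<delta>" "\<delta> \<le> \<delta>'"
  shows "lower_ac_at X f \<delta>' \<le> lower_ac_at X f \<delta>"
  using upper_density_mono[OF sep_times_antimono[OF assms(4), of X f]] assms(3)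
  by (intro ac_at_le(2)[OF ne f, of "\<lambda>x. x" _ _ 1]) auto

lemma lower_ac_prod_ge:
  assumes ne: "mspace X \<noteq> {}" "mspace Y \<noteq> {}"
    and f: "f \<in> mspace X \<rightarrow> mspace X" and g: "g \<in> mspace Y \<rightarrow> mspace Y"
  shows "lower_ac X f + lower_ac Y g \<le> lower_ac (max_metric X Y) (map_prod f g)"
proof -
  let ?P = "max_metric X Y" and ?h = "map_prod f g"
  have at: "lower_ac_at X f \<delta> + lower_ac_at Y g \<delta> \<le> lower_ac_at ?P ?h \<delta>" for \<delta>
  proof -
    note small = eventually_at_right_0_less_1
    have "lower_ac_at X f \<delta> + lower_ac_at Y g \<delta>
        \<le> Liminf (at_right 0) (\<lambda>\<nu>. ln_enat (sep_number X f \<delta> \<nu>) / ereal (- ln \<nu>)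
            + ln_enat (sep_number Y g \<delta> \<nu>) / ereal (- ln \<nu>))"
      unfolding lower_ac_at_def
      by (intro Liminf_add_le log_rate_nonneg ln_enat_nonneg sep_number_ge_1 ne) simp
    also have "\<dots> \<le> lower_ac_at ?P ?h \<delta>"
      unfolding lower_ac_at_def
    proof (rule Liminf_mono, use small in eventually_elim)
      case (elim \<nu>)
      have "ln_enat (sep_number X f \<delta> \<nu>) / ereal (- ln \<nu>) + ln_enat (sep_number Y g \<delta> \<nu>) / ereal (- ln \<nu>)
          = ln_enat (sep_number X f \<delta> \<nu> * sep_number Y g \<delta> \<nu>) / ereal (- ln \<nu>)"
        by (simp add: ln_enat_mult sep_number_ge_1 ne divide_ereal_def ereal_left_distrib ln_enat_nonneg)
      also have "\<dots> \<le> ln_enat (sep_number ?P ?h \<delta> \<nu>) / ereal (- ln \<nu>)"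
        using elim by (intro ereal_divide_right_mono ln_enat_mono sep_number_prod_ge) simp
      finally show ?case .
    qed
    finally show ?thesis .
  qed
  \<comment> \<open>The sum of two suprema is a single supremum: both terms can only grow as the
    scale shrinks, so \<open>min \<delta> \<delta>'\<close> serves for both scales.\<close>
  have "lower_ac X f + lower_ac Y g = (SUP \<delta>\<in>{0<..}. lower_ac_at X f \<delta> + lower_ac_at Y g \<delta>)"
    unfolding lower_ac_def
  proof (rule SUP_ereal_add_directed[symmetric])
    fix \<delta> \<delta>' :: real assume "\<delta> \<in> {0<..}" "\<delta>' \<in> {0<..}"
    then show "\<exists>k\<in>{0<..}. lower_ac_at X f \<delta> + lower_ac_at Y g \<delta>' \<le> lower_ac_at X f k + lower_ac_at Y g k"
      by (intro bexI[of _ "min \<delta> \<delta>'"] add_mono lower_ac_at_antimono ne f g) auto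
  qed (simp_all add: lower_ac_at_nonneg ne)
  also have "\<dots> \<le> lower_ac ?P ?h"
    unfolding lower_ac_def using at by (intro SUP_mono) auto
  finally show ?thesis .
qed

lemma upper_ac_prod_le:
  assumes ne: "mspace X \<noteq> {}" "mspace Y \<noteq> {}"
    and f: "f \<in> mspace X \<rightarrow> mspace X" and g: "g \<in> mspace Y \<rightarrow> mspace Y"
  shows "upper_ac (max_metric X Y) (map_prod f g) \<le> upper_ac X f + upper_ac Y g"
  unfolding upper_ac_def[of "max_metric X Y"]
proof (rule SUP_least)
  let ?P = "max_metric X Y" and ?h = "map_prod f g"
  fix \<delta> :: real assume "\<delta> \<in> {0<..}"
  then have \<delta>: "0 < \<delta>" by simp
  \<comment> \<open>The product bound costs \<open>\<nu> / 4\<close> in frequency and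
    \<open>\<delta> / 2\<close> in scale. The growth rate absorbs the former with
    \<open>c = 1 / 4\<close>, the suprema over scales the latter.\<close>
  have "upper_ac_at ?P ?h \<delta> \<le> Limsup (at_right 0) (\<lambda>\<nu>.
      ln_enat (sep_number X f (\<delta> / 2) \<nu> * sep_number Y g (\<delta> / 2) \<nu>) / ereal (- ln \<nu>))"
    unfolding upper_ac_at_def
  proof (rule log_rate_le(1))
    show "0 \<le> ln_enat (sep_number X f (\<delta> / 2) \<nu> * sep_number Y g (\<delta> / 2) \<nu>)" for \<nu>
      by (simp add: ln_enat_mult ln_enat_nonneg sep_number_ge_1 ne)
    show "ln_enat (sep_number ?P ?h \<delta> \<nu>) \<le> ln_enat (sep_number X f (\<delta> / 2) (1 / 4 * \<nu>)
        * sep_number Y g (\<delta> / 2) (1 / 4 * \<nu>))" if "0 < \<nu>" for \<nu>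
      using sep_number_prod_le[OF f g ne \<delta> that] by (intro ln_enat_mono) simp
  qed simp
  also have "\<dots> = Limsup (at_right 0) (\<lambda>\<nu>. ln_enat (sep_number X f (\<delta> / 2) \<nu>) / ereal (- ln \<nu>)
      + ln_enat (sep_number Y g (\<delta> / 2) \<nu>) / ereal (- ln \<nu>))"
    by (simp add: ln_enat_mult sep_number_ge_1 ne divide_ereal_def ereal_left_distrib ln_enat_nonneg)
  also have "\<dots> \<le> upper_ac_at X f (\<delta> / 2) + upper_ac_at Y g (\<delta> / 2)"
    unfolding upper_ac_at_def
    by (intro Limsup_add_le log_rate_nonneg ln_enat_nonneg sep_number_ge_1 ne) simp
  also have "\<dots> \<le> upper_ac X f + upper_ac Y g"
    unfolding upper_ac_def using \<delta> by (intro add_mono SUP_upper) auto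
  finally show "upper_ac_at ?P ?h \<delta> \<le> upper_ac X f + upper_ac Y g" .
qed

section \<open>The common value, and all invariance properties combined\<close>

lemma ac_eq_upper_ac: "ac_exists X f \<Longrightarrow> ac X f = upper_ac X f"
  unfolding ac_exists_def ac_def by (rule the_equality) auto

theorem proposition1p3:
  fixes X :: "'a metric" and Y :: "'b metric"
    and f :: "'a \<Rightarrow> 'a" and g :: "'b \<Rightarrow> 'b"
  assumes "mspace X \<noteq> {}" and "mspace Y \<noteq> {}"
    and "compact_space (mtopology_of X)" and "compact_space (mtopology_of Y)"
    and "continuous_map (mtopology_of X) (mtopology_of X) f"
    and "continuous_map (mtopology_of Y) (mtopology_of Y) g"
  shows
    "(is_factor X f Y g \<longrightarrow> upper_ac X f \<ge> upper_ac Y g \<and> lower_ac X f \<ge> lower_ac Y g)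
     \<and> (topologically_conjugate X f Y g \<longrightarrow>
          upper_ac X f = upper_ac Y g \<and> lower_ac X f = lower_ac Y g
          \<and> (ac_exists X f \<longleftrightarrow> ac_exists Y g)
          \<and> (ac_exists X f \<longrightarrow> ac X f = ac Y g))
     \<and> (\<forall>m::nat. m \<ge> 1 \<longrightarrow>
          upper_ac X (f ^^ m) = upper_ac X f \<and> lower_ac X (f ^^ m) = lower_ac X f)
     \<and> (ac_exists X f \<and> ac_exists Y g \<longrightarrow>
          ac_exists (max_metric X Y) (map_prod f g)
          \<and> ac (max_metric X Y) (map_prod f g) = ac X f + ac Y g)
     \<and> (\<not> (ac_exists X f \<and> ac_exists Y g) \<longrightarrow>
          upper_ac (max_metric X Y) (map_prod f g) \<le> upper_ac X f + upper_ac Y g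
          \<and> lower_ac (max_metric X Y) (map_prod f g) \<ge> lower_ac X f + lower_ac Y g)
     \<and> (\<forall>g' :: 'a \<Rightarrow> 'a. continuous_map (mtopology_of X) (mtopology_of X) g' \<longrightarrow>
          upper_ac X (f \<circ> g') = upper_ac X (g' \<circ> f)
          \<and> lower_ac X (f \<circ> g') = lower_ac X (g' \<circ> f))"
proof (intro conjI)
  have f: "f \<in> mspace X \<rightarrow> mspace X" and g: "g \<in> mspace Y \<rightarrow> mspace Y"
    using continuous_map_funspace[OF assms(5)] continuous_map_funspace[OF assms(6)] by simp_all
  note upper = upper_ac_prod_le[OF assms(1,2) f g] and lower = lower_ac_prod_ge[OF assms(1,2) f g]
  show "is_factor X f Y g \<longrightarrow> upper_ac X f \<ge> upper_ac Y g \<and> lower_ac X f \<ge> lower_ac Y g"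
    using factor_ac_le[OF assms(1,3) f g] by blast
  show "topologically_conjugate X f Y g \<longrightarrow>
          upper_ac X f = upper_ac Y g \<and> lower_ac X f = lower_ac Y g
          \<and> (ac_exists X f \<longleftrightarrow> ac_exists Y g)
          \<and> (ac_exists X f \<longrightarrow> ac X f = ac Y g)"
  proof
    assume "topologically_conjugate X f Y g"
    note fact = conjugate_imp_factor[OF this f]
    have "upper_ac X f = upper_ac Y g" "lower_ac X f = lower_ac Y g"
      using factor_ac_le[OF assms(1,3) f g fact(1)] factor_ac_le[OF assms(2,4) g f fact(2)]
      by (auto intro: antisym)
    then show "upper_ac X f = upper_ac Y g \<and> lower_ac X f = lower_ac Y g
          \<and> (ac_exists X f \<longleftrightarrow> ac_exists Y g) \<and> (ac_exists X f \<longrightarrow> ac X f = ac Y g)"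
      by (simp add: ac_exists_def ac_def)
  qed
  show "\<forall>m::nat. m \<ge> 1 \<longrightarrow> upper_ac X (f ^^ m) = upper_ac X f \<and> lower_ac X (f ^^ m) = lower_ac X f"
    using power_ac_eq[OF assms(1,3,5)] by blast
  show "ac_exists X f \<and> ac_exists Y g \<longrightarrow>
      ac_exists (max_metric X Y) (map_prod f g) \<and> ac (max_metric X Y) (map_prod f g) = ac X f + ac Y g"
  proof
    assume ex: "ac_exists X f \<and> ac_exists Y g"
    \<comment> \<open>The two general bounds now have the same sum on their outer sides, which
      squeezes the lower and upper values of the product together.\<close>
    then have "upper_ac X f + upper_ac Y g \<le> lower_ac (max_metric X Y) (map_prod f g)"
      using lower by (simp add: ac_exists_def)
    then have eq: "lower_ac (max_metric X Y) (map_prod f g) = upper_ac (max_metric X Y) (map_prod f g)"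
      "upper_ac (max_metric X Y) (map_prod f g) = upper_ac X f + upper_ac Y g"
      using upper lower_ac_le_upper_ac[of "max_metric X Y" "map_prod f g"]
      by (meson antisym order_trans)+
    then have "ac_exists (max_metric X Y) (map_prod f g)"
      by (simp add: ac_exists_def)
    with ex eq(2) show "ac_exists (max_metric X Y) (map_prod f g)
        \<and> ac (max_metric X Y) (map_prod f g) = ac X f + ac Y g"
      by (simp add: ac_eq_upper_ac)
  qed
  show "\<not> (ac_exists X f \<and> ac_exists Y g) \<longrightarrow>
          upper_ac (max_metric X Y) (map_prod f g) \<le> upper_ac X f + upper_ac Y g
          \<and> lower_ac (max_metric X Y) (map_prod f g) \<ge> lower_ac X f + lower_ac Y g"
    using upper lower by blast
  \<comment> \<open>The reverse inequalities come from exchanging \<open>f\<close> and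
    \<open>g'\<close>.\<close>
  show "\<forall>g' :: 'a \<Rightarrow> 'a. continuous_map (mtopology_of X) (mtopology_of X) g' \<longrightarrow>
          upper_ac X (f \<circ> g') = upper_ac X (g' \<circ> f) \<and> lower_ac X (f \<circ> g') = lower_ac X (g' \<circ> f)"
    using comp_ac_le[OF assms(1,3)] assms(5) by (metis antisym)
qed

end
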